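(* Let $X,Y,Z$ be Banach spaces, $U\subset X$ and $V\subset Y$ open sets, let $f:U\to V$ and $g:V\to Z$ be continuous maps, let $Jg$ be a pseudo-Jacobian mapping for $g$ on $V$, and let $x\in U$. If $f$ is Gâteaux differentiable at $x$ and $Jg$ is locally bounded at $f(x)$, then the set $$Jg(f(x))\circ f'(x)=\{S\circ f'(x) : S\in Jg(f(x))\}$$ is a pseudo-Jacobian of $g\circ f$ at $x$.
   Context: Banach spaces are real; $\mathcal{L}(X,Y)$ is the space of bounded linear operators from $X$ to $Y$. For $\varphi:U\to\mathbb{R}$ with $U\subset X$ open, $x\in U$ and $v\in X$, $\varphi'_{+}(x;v)=\limsup_{t\to0^+}\frac{\varphi(x+tv)-\varphi(x)}{t}$. For a map $f:U\to Y$ and $x\in U$, a nonempty set $Jf(x)\subset\mathcal{L}(X,Y)$ is a pseudo-Jacobian of $f$ at $x$ if $(y^*\circ f)'_{+}(x;v)\le\sup\{\langle y^*,T(v)\rangle : T\in Jf(x)\}$ for all $y^*\in Y^*$ and $v\in X$. A set-valued mapping $Jf:U\to2^{\mathcal{L}(X,Y)}$ is a pseudo-Jacobian mapping for $f$ on $U$ if $Jf(x)$ is a pseudo-Jacobian of $f$ at $x$ for every $x\in U$. It is locally bounded at $x$ if there is $r>0$ with $B(x,r)\subset U$ (open ball) such that $Jf(B(x,r))=\{T : T\in Jf(z),\ z\in B(x,r)\}$ is bounded in $\mathcal{L}(X,Y)$. Gâteaux differentiability of $f$ at $x$ means that there is $f'(x)\in\mathcal{L}(X,Y)$ with $\lim_{t\to0}\frac{f(x+tv)-f(x)}{t}=f'(x)(v)$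 in norm for every $v\in X$. *)

theory Defs
  imports "HOL-Analysis.Analysis"
begin

text \<open>
  A map on an open set \<open>U\<close> is represented by a total function. All limits below are taken
  along \<open>x + t v\<close> with \<open>t \<rightarrow> 0\<close>, hence for \<open>x \<in> U\<close> they depend only on the values
  on \<open>U\<close>, and \<open>U\<close> need not be a parameter.
\<close>

text \<open>
  Both the upper limit and the support function \<open>sup {\<langle>y, T v\<rangle>. T \<in> J}\<close> may be infinite,
  so they are taken in \<open>ereal\<close>.
\<close>

definition upper_dir_deriv :: "('a::real_normed_vector \<Rightarrow> real) \<Rightarrow> 'a \<Rightarrow> 'a \<Rightarrow> ereal" where
  "upper_dir_deriv \<phi> x v =
     Limsup (at_right 0) (\<lambda>t::real. ereal ((\<phi> (x + t *\<^sub>R v) - \<phi> x) / t))"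

definition pseudo_Jacobian ::
  "('a::real_normed_vector \<Rightarrow> 'b::real_normed_vector) \<Rightarrow> 'a \<Rightarrow> ('a \<Rightarrow>\<^sub>L 'b) set \<Rightarrow> bool" where
  "pseudo_Jacobian f x J \<longleftrightarrow> J \<noteq> {} \<and>
     (\<forall>(y :: 'b \<Rightarrow>\<^sub>L real) v.
        upper_dir_deriv (blinfun_apply y \<circ> f) x v
          \<le> (SUP T\<in>J. ereal (blinfun_apply y (blinfun_apply T v))))"

definition pseudo_Jacobian_mapping ::
  "('a::real_normed_vector \<Rightarrow> 'b::real_normed_vector) \<Rightarrow> 'a set
     \<Rightarrow> ('a \<Rightarrow> ('a \<Rightarrow>\<^sub>L 'b) set) \<Rightarrow> bool" where
  "pseudo_Jacobian_mapping f U Jf \<longleftrightarrow> (\<forall>x\<in>U. pseudo_Jacobian f x (Jf x))"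

definition locally_bounded_at ::
  "('a::real_normed_vector \<Rightarrow> ('a \<Rightarrow>\<^sub>L 'b::real_normed_vector) set) \<Rightarrow> 'a set \<Rightarrow> 'a \<Rightarrow> bool" where
  "locally_bounded_at Jf U x \<longleftrightarrow>
     (\<exists>r>0. ball x r \<subseteq> U \<and> bounded (\<Union>z\<in>ball x r. Jf z))"

definition has_Gateaux_derivative ::
  "('a::real_normed_vector \<Rightarrow> 'b::real_normed_vector) \<Rightarrow> ('a \<Rightarrow>\<^sub>L 'b) \<Rightarrow> 'a \<Rightarrow> bool" where
  "has_Gateaux_derivative f f' x \<longleftrightarrow>
     (\<forall>v. ((\<lambda>t::real. (f (x + t *\<^sub>R v) - f x) /\<^sub>R t) \<longlongrightarrow> blinfun_apply f' v) (at 0))"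

end

theory Submission
  imports Defs
begin

text \<open>
  Near \<open>f x\<close> the bound on \<open>Jg\<close> makes every scalar function \<open>y \<circ> g\<close> Lipschitz: along a segment its
  upper right Dini derivative is at most the support function of a bounded set of operators, and a
  continuous function with bounded upper Dini derivative obeys the mean value inequality
  (\<open>Dini_mean_value_inequality\<close>, \<open>pseudo_Jacobian_Lipschitz\<close>). Since \<open>f\<close> is Gateaux differentiable
  at \<open>x\<close>, the points \<open>f (x + t v)\<close> and \<open>f x + t f' v\<close> differ by \<open>o(t)\<close>, so the Lipschitz bound lets
  the former be replaced by the latter in the difference quotient of \<open>y \<circ> g \<circ> f\<close>. What remains is
  the difference quotient of \<open>y \<circ> g\<close> at \<open>f x\<close> in the direction \<open>f' v\<close>, which \<open>Jg (f x)\<close> controls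
  by assumption.
\<close>

text \<open>
  If the conclusion fails, it fails with a slope \<open>K > C\<close>. Then the last point \<open>s\<close> at which the
  graph of \<open>\<phi>\<close> is on or below the line of slope \<open>K\<close> through \<open>(a, \<phi> a)\<close> lies before \<open>b\<close>; but the Dini
  derivative at \<open>s\<close> is less than \<open>K\<close>, so the graph stays on or below that line just after \<open>s\<close>.
\<close>

lemma Dini_mean_value_inequality:
  fixes \<phi> :: "real \<Rightarrow> real"
  assumes "a \<le> b" and cont: "continuous_on {a..b} \<phi>"
    and Dini: "\<And>s. a \<le> s \<Longrightarrow> s < b \<Longrightarrow> upper_dir_deriv \<phi> s 1 \<le> ereal C"
  shows "\<phi> b - \<phi> a \<le> C * (b - a)"
proof (rule ccontr)
  assume neg: "\<not> ?thesis"
  with \<open>a \<le> b\<close> have "a < b" by (cases "a = b") auto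
  with neg have "C < (\<phi> b - \<phi> a) / (b - a)" by (simp add: field_simps)
  then obtain K where K: "C < K" "K < (\<phi> b - \<phi> a) / (b - a)" using dense by blast
  define \<psi> where "\<psi> t = \<phi> t - K * t" for t
  define S where "S = {t \<in> {a..b}. \<psi> t \<le> \<psi> a}"
  have \<psi>b: "\<psi> a < \<psi> b"
    using K(2) \<open>a < b\<close> by (simp add: \<psi>_def field_simps)
  have "continuous_on {a..b} \<psi>"
    unfolding \<psi>_def by (intro continuous_intros cont)
  then have "closed S"
    unfolding S_def by (intro continuous_closed_preimage_constant
        continuous_on_closed_Collect_le continuous_on_const closed_atLeastAtMost)
  moreover have "S \<subseteq> {a..b}" by (auto simp: S_def)
  then have bdd: "bdd_above S" by (meson bdd_above_Icc bdd_above_mono)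
  moreover have "a \<in> S" using \<open>a \<le> b\<close> by (simp add: S_def)
  ultimately have SupS: "Sup S \<in> S" by (intro closed_contains_Sup) auto
  define s where "s = Sup S"
  have s: "a \<le> s" "s \<le> b" "\<psi> s \<le> \<psi> a" using SupS by (auto simp: S_def s_def)
  have "s < b" using s \<psi>b by (cases "s = b") auto
  have "upper_dir_deriv \<phi> s 1 < ereal K"
    using Dini[OF s(1) \<open>s < b\<close>] K(1) by (meson ereal_less_ereal_Ex less_ereal.simps(1) order_le_less_trans)
  then have "\<forall>\<^sub>F t in at_right 0. ereal ((\<phi> (s + t *\<^sub>R 1) - \<phi> s) / t) < ereal K"
    unfolding upper_dir_deriv_def by (rule Limsup_lessD)
  moreover have "\<forall>\<^sub>F t::real in at_right 0. t < b - s"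
    using \<open>s < b\<close> by (intro eventually_at_rightI[of 0 "b - s"]) auto
  moreover have "\<forall>\<^sub>F t::real in at_right 0. 0 < t"
    by (rule eventually_at_right_less)
  ultimately have "\<forall>\<^sub>F t in at_right (0::real). 0 < t \<and> s + t \<in> S"
  proof eventually_elim
    case (elim t)
    then have "\<psi> (s + t) \<le> \<psi> s" by (simp add: \<psi>_def field_simps)
    with elim s show ?case by (simp add: S_def)
  qed
  then obtain t where t: "0 < t" "s + t \<in> S"
    using eventually_happens trivial_limit_at_right_real by blast
  then have "s + t \<le> s" unfolding s_def using bdd by (intro cSup_upper)
  with t show False by simp
qed

text \<open>
  The Dini derivative of \<open>y \<circ> g\<close> along the segment from \<open>a\<close> to \<open>b\<close> is an upper directional derivative
  of \<open>y \<circ> g\<close> in the direction \<open>b - a\<close>, so the bound on the operators turns into a bound on slopes.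
  Exchanging \<open>a\<close> and \<open>b\<close> gives the other half of the Lipschitz estimate.
\<close>

lemma pseudo_Jacobian_Lipschitz:
  fixes g :: "'b::real_normed_vector \<Rightarrow> 'c::real_normed_vector" and y :: "'c \<Rightarrow>\<^sub>L real"
  assumes "convex S" and cont: "continuous_on S g" and Jg: "pseudo_Jacobian_mapping g S Jg"
    and bound: "\<And>z T. z \<in> S \<Longrightarrow> T \<in> Jg z \<Longrightarrow> norm T \<le> M"
    and "a \<in> S" "b \<in> S"
  shows "y (g b) - y (g a) \<le> norm y * M * norm (b - a)"
proof -
  define l where "l s = a + s *\<^sub>R (b - a)" for s
  have l: "l s \<in> S" if "0 \<le> s" "s \<le> 1" for s
    using convexD_alt[OF \<open>convex S\<close> \<open>a \<in> S\<close> \<open>b \<in> S\<close> that]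
    by (simp add: l_def algebra_simps)
  have "continuous_on {0..1} (\<lambda>s. y (g (l s)))"
  proof (intro continuous_intros continuous_on_compose2[OF cont])
    show "continuous_on {0..1} l" unfolding l_def by (intro continuous_intros)
  qed (use l in auto)
  moreover have "upper_dir_deriv (\<lambda>s. y (g (l s))) s 1 \<le> ereal (norm y * M * norm (b - a))"
    if s: "0 \<le> s" "s < 1" for s
  proof -
    have "upper_dir_deriv (\<lambda>s. y (g (l s))) s 1 = upper_dir_deriv (blinfun_apply y \<circ> g) (l s) (b - a)"
      by (simp add: upper_dir_deriv_def l_def scaleR_left_distrib add.assoc)
    also have "\<dots> \<le> (SUP T\<in>Jg (l s). ereal (y (blinfun_apply T (b - a))))"
      using Jg l[of s] s by (simp add: pseudo_Jacobian_mapping_def pseudo_Jacobian_def)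
    also have "\<dots> \<le> ereal (norm y * M * norm (b - a))"
    proof (rule SUP_least)
      fix T assume T: "T \<in> Jg (l s)"
      have "y (T (b - a)) \<le> norm (y (T (b - a)))" by simp
      also have "\<dots> \<le> norm y * norm (T (b - a))" by (rule norm_blinfun)
      also have "\<dots> \<le> norm y * (norm T * norm (b - a))"
        by (intro mult_left_mono norm_blinfun norm_ge_zero)
      also have "\<dots> \<le> norm y * (M * norm (b - a))"
        using bound[OF l T] s by (intro mult_left_mono mult_right_mono) auto
      finally show "ereal (y (T (b - a))) \<le> ereal (norm y * M * norm (b - a))"
        by (simp add: mult.assoc)
    qed
    finally show ?thesis .
  qed
  ultimately have "y (g (l 1)) - y (g (l 0)) \<le> norm y * M * norm (b - a) * (1 - 0)"
    by (intro Dini_mean_value_inequality) auto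
  then show ?thesis by (simp add: l_def)
qed

text \<open>
  The upper derivative sees only the first-order behaviour of a curve: if \<open>h\<close> is Lipschitz
  near \<open>p\<close>, replacing a curve by its tangent at \<open>p\<close> changes \<open>h\<close> by \<open>o(t)\<close> only.
\<close>

lemma Limsup_curve_le_upper_dir_deriv:
  fixes h :: "'b::real_normed_vector \<Rightarrow> real" and c :: "real \<Rightarrow> 'b"
  assumes "0 < r"
    and Lip: "\<And>z w. z \<in> ball p r \<Longrightarrow> w \<in> ball p r \<Longrightarrow> h w - h z \<le> L * norm (w - z)"
    and tangent: "((\<lambda>t. (c t - p) /\<^sub>R t) \<longlongrightarrow> u) (at_right 0)"
  shows "Limsup (at_right 0) (\<lambda>t. ereal ((h (c t) - h p) / t)) \<le> upper_dir_deriv h p u"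
  unfolding Limsup_le_iff
proof (intro allI impI)
  fix \<beta> assume "upper_dir_deriv h p u < \<beta>"
  \<comment> \<open>The gap between \<open>c1\<close> and \<open>c2\<close> absorbs the error of passing from the curve to its tangent.\<close>
  then obtain c2 where c2: "upper_dir_deriv h p u < ereal c2" "ereal c2 < \<beta>"
    using ereal_dense2 by blast
  then obtain c1 where c1: "upper_dir_deriv h p u < ereal c1" "c1 < c2"
    using ereal_dense2[OF c2(1)] by auto
  have pos: "\<forall>\<^sub>F t::real in at_right 0. 0 < t"
    by (rule eventually_at_right_less)
  have id0: "((\<lambda>t::real. t) \<longlongrightarrow> 0) (at_right 0)" by (rule tendsto_ident_at)
  have "((\<lambda>t. p + t *\<^sub>R u) \<longlongrightarrow> p + 0 *\<^sub>R u) (at_right 0)"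
    by (intro tendsto_intros id0)
  then have near_tangent: "\<forall>\<^sub>F t in at_right 0. p + t *\<^sub>R u \<in> ball p r"
    using \<open>0 < r\<close> by (intro topological_tendstoD[where l=p]) auto
  have "((\<lambda>t. p + t *\<^sub>R ((c t - p) /\<^sub>R t)) \<longlongrightarrow> p + 0 *\<^sub>R u) (at_right 0)"
    by (intro tendsto_intros id0 tangent)
  then have "\<forall>\<^sub>F t in at_right 0. p + t *\<^sub>R ((c t - p) /\<^sub>R t) \<in> ball p r"
    using \<open>0 < r\<close> by (intro topological_tendstoD[where l=p]) auto
  with pos have near_curve: "\<forall>\<^sub>F t in at_right 0. c t \<in> ball p r"
    by eventually_elim simp
  have "((\<lambda>t. L * norm ((c t - p) /\<^sub>R t - u)) \<longlongrightarrow> L * norm (u - u)) (at_right 0)"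
    by (intro tendsto_intros tangent)
  then have error: "\<forall>\<^sub>F t in at_right 0. L * norm ((c t - p) /\<^sub>R t - u) < c2 - c1"
    using c1(2) by (intro order_tendstoD(2)) auto
  have "\<forall>\<^sub>F t in at_right 0. ereal ((h (p + t *\<^sub>R u) - h p) / t) < ereal c1"
    using c1(1) unfolding upper_dir_deriv_def by (rule Limsup_lessD)
  with pos near_tangent near_curve error
  show "\<forall>\<^sub>F t in at_right 0. ereal ((h (c t) - h p) / t) < \<beta>"
  proof eventually_elim
    case (elim t)
    have "c t - (p + t *\<^sub>R u) = t *\<^sub>R ((c t - p) /\<^sub>R t - u)"
      using elim(1) by (simp add: algebra_simps)
    then have "norm (c t - (p + t *\<^sub>R u)) = t * norm ((c t - p) /\<^sub>R t - u)"
      using elim(1) by simp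
    then have "h (c t) - h (p + t *\<^sub>R u) \<le> t * (L * norm ((c t - p) /\<^sub>R t - u))"
      using Lip[OF elim(2,3)] by (simp add: mult.left_commute)
    also have "\<dots> < t * (c2 - c1)"
      using elim(1,4) by simp
    finally have "h (c t) - h p < t * (c2 - c1) + (h (p + t *\<^sub>R u) - h p)" by simp
    also have "\<dots> < t * c2"
      using elim(1,5) by (simp add: field_simps)
    finally have "(h (c t) - h p) / t < c2"
      using elim(1) by (simp add: field_simps)
    with c2(2) show ?case by (meson less_ereal.simps(1) less_trans)
  qed
qed

theorem proposition2p12:
  fixes f :: "'a::banach \<Rightarrow> 'b::banach"
    and g :: "'b \<Rightarrow> 'c::banach"
    and U :: "'a set" and V :: "'b set"
    and Jg :: "'b \<Rightarrow> ('b \<Rightarrow>\<^sub>L 'c) set"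
    and f' :: "'a \<Rightarrow>\<^sub>L 'b"
    and x :: 'a
  assumes "open U" and "open V"
    and "f ` U \<subseteq> V"
    and "continuous_on U f" and "continuous_on V g"
    and "pseudo_Jacobian_mapping g V Jg"
    and "x \<in> U"
    and "has_Gateaux_derivative f f' x"
    and "locally_bounded_at Jg V (f x)"
  shows "pseudo_Jacobian (g \<circ> f) x {S o\<^sub>L f' | S. S \<in> Jg (f x)}"
proof -
  obtain r where r: "0 < r" "ball (f x) r \<subseteq> V" "bounded (\<Union>z\<in>ball (f x) r. Jg z)"
    using assms(9) unfolding locally_bounded_at_def by blast
  obtain M where M: "\<And>z T. z \<in> ball (f x) r \<Longrightarrow> T \<in> Jg z \<Longrightarrow> norm T \<le> M"
    using r(3) unfolding bounded_iff by blast
  have Jg_ball: "pseudo_Jacobian_mapping g (ball (f x) r) Jg"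
    using assms(6) r(2) unfolding pseudo_Jacobian_mapping_def by blast
  have Jgfx: "pseudo_Jacobian g (f x) (Jg (f x))"
    using Jg_ball r(1) unfolding pseudo_Jacobian_mapping_def by simp
  have "upper_dir_deriv (blinfun_apply y \<circ> (g \<circ> f)) x v
      \<le> (SUP T\<in>{S o\<^sub>L f' | S. S \<in> Jg (f x)}. ereal (y (blinfun_apply T v)))" for y :: "'c \<Rightarrow>\<^sub>L real" and v
  proof -
    have Lip: "(blinfun_apply y \<circ> g) w - (blinfun_apply y \<circ> g) z \<le> norm y * M * norm (w - z)"
      if "z \<in> ball (f x) r" "w \<in> ball (f x) r" for z w
      using pseudo_Jacobian_Lipschitz[OF convex_ball continuous_on_subset[OF assms(5) r(2)]
          Jg_ball M that] by simp
    have "((\<lambda>t. (f (x + t *\<^sub>R v) - f x) /\<^sub>R t) \<longlongrightarrow> f' v) (at_right 0)"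
      using assms(8) unfolding has_Gateaux_derivative_def
      by (meson tendsto_within_subset subset_UNIV)
    from Limsup_curve_le_upper_dir_deriv[OF r(1) Lip this]
    have "upper_dir_deriv (blinfun_apply y \<circ> (g \<circ> f)) x v
        \<le> upper_dir_deriv (blinfun_apply y \<circ> g) (f x) (f' v)"
      by (simp add: upper_dir_deriv_def)
    also have "\<dots> \<le> (SUP S\<in>Jg (f x). ereal (y (blinfun_apply S (f' v))))"
      using Jgfx unfolding pseudo_Jacobian_def by blast
    also have "\<dots> = (SUP T\<in>{S o\<^sub>L f' | S. S \<in> Jg (f x)}. ereal (y (blinfun_apply T v)))"
      by (simp add: setcompr_eq_image image_image)
    finally show ?thesis .
  qed
  moreover have "{S o\<^sub>L f' | S. S \<in> Jg (f x)} \<noteq> {}"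
    using Jgfx unfolding pseudo_Jacobian_def by blast
  ultimately show ?thesis unfolding pseudo_Jacobian_def by blast
qed

end
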